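(* Let $\beta>0$. (i) If $f\in L^p(\mathbb{R})$ for some $1<p\le2$, then $\widehat{\mathcal{C}_\beta f}=\mathcal{C}_\beta^*\hat f$ (almost everywhere). (ii) If $f\in L^p(\mathbb{R})$ for some $1\le p\le2$, then $\widehat{\mathcal{C}_\beta^*f}=\mathcal{C}_\beta\hat f$ (almost everywhere).
   Context: The Fourier transform of $f\in L^1(\mathbb{R})$ is $\hat f(t)=\int_{-\infty}^\infty e^{-ixt}f(x)\,dx$; for $f\in L^p(\mathbb{R})$ with $1<p\le2$, $\hat f\in L^{p'}(\mathbb{R})$ ($\frac1p+\frac1{p'}=1$) is the $L^{p'}$-limit of $\int_{-R}^Re^{-ixt}f(x)\,dx$ as $R\to\infty$. The generalized Cesàro operator on $\mathbb{R}$ is $\mathcal{C}_\beta f(t)=\frac{\beta}{|t|^\beta}\int_t^0(s-t)^{\beta-1}f(s)\,ds$ for $t<0$, $\mathcal{C}_\beta f(t)=\frac{\beta}{t^\beta}\int_0^t(t-s)^{\beta-1}f(s)\,ds$ for $t>0$ (and $\mathcal{C}_\beta f(0)=f(0)$), i.e. $\mathcal{C}_\beta f(t)=\beta\int_0^1(1-r)^{\beta-1}f(tr)\,dr$. The generalized dual Cesàro operator is $\mathcal{C}_\beta^*f(t)=\beta\int_{-\infty}^t\frac{(t-s)^{\beta-1}}{|s|^\beta}f(s)\,ds$ for $t<0$, $\mathcal{C}_\beta^*f(t)=\beta\int_t^\infty\frac{(s-t)^{\beta-1}}{s^\beta}f(s)\,ds$ for $t>0$ (and $\mathcal{C}_\beta^*f(0)=0$).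 *)

theory Defs
  imports "HOL-Analysis.Analysis"
begin

definition memLp :: "real \<Rightarrow> (real \<Rightarrow> complex) \<Rightarrow> bool" where
  "memLp p f \<longleftrightarrow> f \<in> borel_measurable lborel \<and>
     (\<integral>\<^sup>+ x. ennreal (norm (f x) powr p) \<partial>lborel) < \<infinity>"

definition trunc_fourier :: "(real \<Rightarrow> complex) \<Rightarrow> real \<Rightarrow> real \<Rightarrow> complex" where
  "trunc_fourier f R t = (\<integral>x\<in>{-R..R}. exp (- \<i> * complex_of_real (x * t)) * f x \<partial>lborel)"

definition fourier_L1 :: "(real \<Rightarrow> complex) \<Rightarrow> real \<Rightarrow> complex" where
  "fourier_L1 f t = (\<integral>x. exp (- \<i> * complex_of_real (x * t)) * f x \<partial>lborel)"

text \<open>is_fourier p f g: g is the Fourier transform of f \<in> L^p. For p = 1 it is the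
  Lebesgue integral; for 1 < p \<le> 2 it is (a representative of) the L^{p'} limit of
  the truncated integrals, p' = p/(p-1).\<close>
definition is_fourier :: "real \<Rightarrow> (real \<Rightarrow> complex) \<Rightarrow> (real \<Rightarrow> complex) \<Rightarrow> bool" where
  "is_fourier p f g \<longleftrightarrow>
     (p = 1 \<and> (\<forall>t. g t = fourier_L1 f t)) \<or>
     (1 < p \<and> p \<le> 2 \<and> memLp (p / (p - 1)) g \<and>
        ((\<lambda>R. (\<integral>\<^sup>+ t. ennreal (norm (trunc_fourier f R t - g t) powr (p / (p - 1))) \<partial>lborel))
           \<longlongrightarrow> 0) at_top)"

definition cesaro :: "real \<Rightarrow> (real \<Rightarrow> complex) \<Rightarrow> real \<Rightarrow> complex" where
  "cesaro \<beta> f t = (\<integral>r\<in>{0..1}. complex_of_real (\<beta> * (1 - r) powr (\<beta> - 1)) * f (t * r) \<partial>lborel)"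

definition cesaro_dual :: "real \<Rightarrow> (real \<Rightarrow> complex) \<Rightarrow> real \<Rightarrow> complex" where
  "cesaro_dual \<beta> f t =
     (if t < 0 then
        (\<integral>s\<in>{..<t}. complex_of_real (\<beta> * (t - s) powr (\<beta> - 1) / \<bar>s\<bar> powr \<beta>) * f s \<partial>lborel)
      else if 0 < t then
        (\<integral>s\<in>{t<..}. complex_of_real (\<beta> * (s - t) powr (\<beta> - 1) / s powr \<beta>) * f s \<partial>lborel)
      else 0)"

end

theory Submission
  imports Defs "HOL-Probability.Sinc_Integral"
begin

text \<open>
  Both operators are averages of dilations, \<open>T f(t) = \<integral> k(r) f(t a(r)) dr\<close>: for the Cesaro operator
  \<open>k(r) = \<beta>(1-r)\<^bsup>\<beta>-1\<^esup>\<close> and \<open>a(r) = r\<close> on the unit interval, and for its dual, after the substitution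
  \<open>s = t/r\<close>, the kernel is \<open>k(r)/r\<close> and the factor is \<open>1/r\<close>. The Fourier transform turns the dilation
  by \<open>a\<close> into \<open>1/a\<close> times the dilation by \<open>1/a\<close>, so it exchanges the two. The operator is bounded on
  \<open>L\<^sup>p\<close> whenever \<open>k a\<^bsup>-1/p\<^esup>\<close> is integrable, by Jensen's inequality for that weight; here this is a Beta
  integral. For \<open>p > 1\<close> the identity is tested against indicators of intervals: their transforms lie in
  \<open>L\<^bsup>p'\<^esup>\<close> and a dilated indicator is again one of an interval, so Fubini's theorem suffices.
\<close>

section \<open>Uniqueness from integrals over intervals\<close>

text \<open>Closed intervals are an intersection-stable generator of the Borel sets, so vanishing
  integrals propagate to all Borel sets by a Dynkin argument. Cutting \<open>f\<close> to [-n, n]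
  first makes it integrable on the whole line.\<close>

lemma AE_eq_0_of_interval_integrals:
  fixes f :: "real \<Rightarrow> complex"
  assumes int: "\<And>c d. set_integrable lborel {c..d} f"
    and zero: "\<And>c d. c \<le> d \<Longrightarrow> (LINT x:{c..d}|lborel. f x) = 0"
  shows "AE x in lborel. f x = 0"
proof -
  \<comment> \<open>Empty intervals are included because they arise when an interval is cut to
    [-n, n].\<close>
  have zero': "(LINT x:{c..d}|lborel. f x) = 0" for c d
    using zero[of c d] by (cases "c \<le> d") (auto simp: set_lebesgue_integral_def)
  have "AE x in lborel. indicator {- real n..real n} x *\<^sub>R f x = 0" for n
  proof (rule sigma_finite_measure.density_zero[OF sigma_finite_lborel])
    let ?F = "\<lambda>x. indicator {- real n..real n} x *\<^sub>R f x"
    show F: "integrable lborel ?F"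
      using int[of "- real n" "real n"] by (simp add: set_integrable_def)
    have FA: "set_integrable lborel A ?F" if "A \<in> sets lborel" for A
      using integrable_mult_indicator[OF that F] by (simp add: set_integrable_def)
    fix A :: "real set" assume "A \<in> sets lborel"
    then have A: "A \<in> sigma_sets UNIV (range (\<lambda>(a, b). {a..b}))"
      by (simp add: borel_eq_atLeastAtMost)
    have sets: "sigma_sets UNIV (range (\<lambda>(a, b). {a..b::real})) = sets lborel"
      by (simp add: borel_eq_atLeastAtMost)
    have "Int_stable (range (\<lambda>(a, b). {a..b::real}))"
      by (auto simp: Int_stable_def)
    moreover have "range (\<lambda>(a, b). {a..b::real}) \<subseteq> Pow UNIV" by simp
    ultimately show "(LINT x:A|lborel. ?F x) = 0" using A
    proof (induction rule: sigma_sets_induct_disjoint)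
      case (basic A)
      then obtain a b where A: "A = {a..b}" by auto
      have "(LINT x:A|lborel. ?F x) = (LINT x:{max a (- real n)..min b (real n)}|lborel. f x)"
        unfolding set_lebesgue_integral_def A
        by (intro Bochner_Integration.integral_cong) (auto split: split_indicator)
      then show ?case by (simp add: zero')
    next
      case empty
      then show ?case by (simp add: set_lebesgue_integral_def)
    next
      case (compl A)
      then have A: "A \<in> sets lborel" by (simp add: sets)
      \<comment> \<open>The integral of \<open>?F\<close> over the whole line is the one of
        \<open>f\<close> over [-n, n], hence 0; this settles complements.\<close>
      have "(LINT x:A \<union> (UNIV - A)|lborel. ?F x) = (LINT x:A|lborel. ?F x) + (LINT x:UNIV - A|lborel. ?F x)"
        using A by (intro set_integral_Un FA) auto
      moreover have "(LINT x:A \<union> (UNIV - A)|lborel. ?F x) = 0"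
        using zero'[of "- real n" "real n"] by (simp add: set_lebesgue_integral_def)
      ultimately show ?case using compl by simp
    next
      case (union A)
      then have A: "A i \<in> sets lborel" for i unfolding sets by auto
      have "(LINT x:(\<Union>i. A i)|lborel. ?F x) = (\<Sum>i. (LINT x:A i|lborel. ?F x))"
        using union A by (intro lebesgue_integral_countable_add FA) (auto simp: disjoint_family_on_def)
      then show ?case using union by simp
    qed
  qed
  then have "AE x in lborel. \<forall>n. indicator {- real n..real n} x *\<^sub>R f x = 0"
    by (simp only: AE_all_countable) blast
  then show ?thesis
  proof eventually_elim
    case (elim x)
    obtain n where "\<bar>x\<bar> \<le> real n" using real_arch_simple by blast
    then have "x \<in> {- real n..real n}" by auto
    with elim[rule_format, of n] show ?case by simp
  qed
qed

section \<open>Young's and Jensen's inequalities\<close>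

text \<open>Young's inequality with its factors 1/p and 1/q bounded by 1. It serves only to prove
  integrability, where constants do not matter.\<close>

lemma mult_le_powr_add:
  fixes a b p q :: real
  assumes "p > 1" "q > 1" "1 / p + 1 / q = 1" "a \<ge> 0" "b \<ge> 0"
  shows "a * b \<le> a powr p + b powr q"
proof -
  have "a powr p / p \<le> a powr p / 1" "b powr q / q \<le> b powr q / 1"
    using assms by (intro divide_left_mono; simp)+
  then show ?thesis using Youngs_inequality[OF assms] by linarith
qed

text \<open>The convex function \<open>x powr p\<close> lies above its tangent at \<open>c\<close>.
  The inequality is Young's for \<open>x\<close> and \<open>c powr (p - 1)\<close>, since the
  conjugate exponent q satisfies (p - 1) q = p.\<close>

lemma powr_tangent:
  fixes x c p :: real
  assumes "p \<ge> 1" "x \<ge> 0" "c > 0"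
  shows "p * c powr (p - 1) * x \<le> x powr p + (p - 1) * c powr p"
proof (cases "p = 1")
  case True
  then show ?thesis using assms by simp
next
  case False
  with assms have p: "p > 1" by simp
  define q where "q = p / (p - 1)"
  have q: "q > 1" "1 / p + 1 / q = 1" "(p - 1) * q = p" "1 / q = (p - 1) / p"
    using p by (auto simp: q_def field_simps)
  have "x * c powr (p - 1) \<le> x powr p / p + (c powr (p - 1)) powr q / q"
    using assms p q by (intro Youngs_inequality) auto
  also have "(c powr (p - 1)) powr q / q = c powr p * (1 / q)"
    by (simp add: powr_powr q(3))
  also have "\<dots> = c powr p * ((p - 1) / p)" by (simp only: q(4))
  finally show ?thesis using p by (simp add: field_simps)
qed

text \<open>Jensen's inequality for the finite measure with density \<open>m\<close>, obtained by
  integrating the tangent inequality at the weighted mean of \<open>norm (Z r)\<close>. The right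
  side is an extended nonnegative integral, so it may be infinite.\<close>

lemma norm_integral_powr_le:
  fixes Z :: "'a \<Rightarrow> complex" and m :: "'a \<Rightarrow> real"
  assumes m: "integrable M m" "\<And>r. m r \<ge> 0" and [measurable]: "Z \<in> borel_measurable M" and p: "p \<ge> 1"
  shows "ennreal (norm (\<integral>r. of_real (m r) * Z r \<partial>M) powr p)
     \<le> ennreal ((\<integral>r. m r \<partial>M) powr (p - 1)) * (\<integral>\<^sup>+ r. ennreal (m r * norm (Z r) powr p) \<partial>M)"
proof -
  have [measurable]: "m \<in> borel_measurable M" using m by auto
  define K where "K = (\<integral>r. m r \<partial>M)"
  define S where "S = (\<integral>r. m r * norm (Z r) \<partial>M)"
  have norm_S: "norm (\<integral>r. of_real (m r) * Z r \<partial>M) \<le> S"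
    unfolding S_def by (rule order_trans[OF integral_norm_bound]) (simp add: norm_mult m(2))
  have "K \<ge> 0" unfolding K_def using m by simp
  show ?thesis
  \<comment> \<open>In the degenerate cases \<open>S\<close> is 0: \<open>m\<close> vanishes almost
    everywhere, or the integral takes its default value 0. The left side then vanishes by
    \<open>norm_S\<close>.\<close>
  proof (cases "K = 0 \<or> S \<le> 0 \<or> \<not> integrable M (\<lambda>r. m r * norm (Z r))")
    case True
    have "S = 0" 
    proof (cases "K = 0")
      case True
      then have "AE r in M. m r = 0"
        using m by (subst (asm) K_def, subst (asm) integral_nonneg_eq_0_iff_AE) auto
      then have "S = (\<integral>r. 0 \<partial>M)" unfolding S_def
        by (intro integral_cong_AE) auto
      then show ?thesis by simp
    next
      case False
      moreover have "S \<ge> 0" unfolding S_def using m by simp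
      ultimately show ?thesis using \<open>K = 0 \<or> S \<le> 0 \<or> _\<close>
        by (auto simp: S_def not_integrable_integral_eq)
    qed
    then show ?thesis using norm_S p by simp
  next
    case False
    then have K: "K > 0" and S: "S > 0" and iS: "integrable M (\<lambda>r. m r * norm (Z r))"
      using \<open>K \<ge> 0\<close> by auto
    show ?thesis
    proof (cases "integrable M (\<lambda>r. m r * norm (Z r) powr p)")
      case True
      define B where "B = (\<integral>r. m r * norm (Z r) powr p \<partial>M)"
      \<comment> \<open>The mean of \<open>norm (Z r)\<close> under the weight \<open>m\<close>:
        touching the curve there gives the constant of Jensen's inequality.\<close>
      define c where "c = S / K"
      have c: "c > 0" "S = c * K" using K S by (auto simp: c_def)
      have "(\<integral>r. p * c powr (p - 1) * (m r * norm (Z r)) \<partial>M) \<le> (\<integral>r. m r * norm (Z r) powr p + (p - 1) * c powr p * m r \<partial>M)"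
      proof (rule integral_mono)
        fix r
        have "m r * (p * c powr (p - 1) * norm (Z r)) \<le> m r * (norm (Z r) powr p + (p - 1) * c powr p)"
          using p c m by (intro mult_left_mono powr_tangent) auto
        then show "p * c powr (p - 1) * (m r * norm (Z r)) \<le> m r * norm (Z r) powr p + (p - 1) * c powr p * m r"
          by (simp add: algebra_simps)
      qed (use True m iS in auto)
      then have le: "p * c powr (p - 1) * S \<le> B + (p - 1) * c powr p * K"
        using True m iS by (simp add: B_def S_def K_def)
      have "p * c powr (p - 1) * S = p * (c powr p * K)"
        using c by (simp add: powr_diff)
      then have "c powr p * K \<le> B" using le by (simp only:) (simp add: algebra_simps)
      then have "c powr p * K * K powr (p - 1) \<le> B * K powr (p - 1)"
        by (intro mult_right_mono) auto
      also have "c powr p * K * K powr (p - 1) = S powr p"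
        using c K by (simp add: powr_diff powr_mult)
      finally have "norm (\<integral>r. of_real (m r) * Z r \<partial>M) powr p \<le> K powr (p - 1) * B"
        using norm_S p powr_mono2[of p "norm (\<integral>r. of_real (m r) * Z r \<partial>M)" S] by (simp add: mult.commute)
      then have "ennreal (norm (\<integral>r. of_real (m r) * Z r \<partial>M) powr p) \<le> ennreal (K powr (p - 1)) * ennreal B"
        by (subst ennreal_mult[symmetric]) (auto simp: B_def m intro!: integral_nonneg_AE)
      also have "ennreal B = (\<integral>\<^sup>+ r. ennreal (m r * norm (Z r) powr p) \<partial>M)"
        unfolding B_def using True m by (intro nn_integral_eq_integral[symmetric]) auto
      finally show ?thesis by (simp add: K_def)
    next
      case False
      then have "(\<integral>\<^sup>+ r. ennreal (m r * norm (Z r) powr p) \<partial>M) = \<infinity>"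
        using m by (auto simp: integrable_iff_bounded less_top[symmetric])
      then show ?thesis using K by (simp add: K_def ennreal_mult_top)
    qed
  qed
qed

section \<open>Dilations and their averages on L^p\<close>

lemma memLp_iff_integrable:
  "memLp p f \<longleftrightarrow> f \<in> borel_measurable borel \<and> integrable lborel (\<lambda>x. norm (f x) powr p)"
  unfolding memLp_def integrable_iff_bounded by auto

lemma memLp_measurable: "memLp p f \<Longrightarrow> f \<in> borel_measurable borel"
  by (simp add: memLp_iff_integrable)

lemma nn_integral_dilation:
  fixes c :: real
  assumes [measurable]: "F \<in> borel_measurable borel" and "c > 0"
  shows "ennreal c * (\<integral>\<^sup>+x. F (x * c) \<partial>lborel) = (\<integral>\<^sup>+x. F x \<partial>lborel)"
  using nn_integral_real_affine[of F c 0] assms by (simp add: mult.commute)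

lemma integral_dilation:
  fixes F :: "real \<Rightarrow> complex" and c :: real
  assumes "c > 0"
  shows "(\<integral>x. F (x * c) \<partial>lborel) = (\<integral>x. F x / of_real c \<partial>lborel)"
  using lborel_integral_real_affine[of c F 0] assms 
  by (simp add: mult.commute scaleR_conv_of_real)

definition dilation_avg :: "(real \<Rightarrow> real) \<Rightarrow> (real \<Rightarrow> real) \<Rightarrow> (real \<Rightarrow> complex) \<Rightarrow> real \<Rightarrow> complex"
  where "dilation_avg k a f t = (\<integral>r. of_real (k r) * f (t * a r) \<partial>lborel)"

text \<open>Positivity of \<open>a\<close> is demanded also where \<open>k\<close> vanishes, so that
  passing to 1/a yields a kernel of the same kind. Integrability depends on the exponent and is
  assumed lemma by lemma.\<close>

locale dilation_kernel =
  fixes k a :: "real \<Rightarrow> real"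
  assumes k_measurable [measurable]: "k \<in> borel_measurable borel"
    and a_measurable [measurable]: "a \<in> borel_measurable borel"
    and k_nonneg: "\<And>r. k r \<ge> 0"
    and a_pos: "\<And>r. a r > 0"
begin

text \<open>This is the kernel found on the Fourier side: the transform of the dilation by a is the
  dilation by 1/a, divided by a.\<close>

lemma dual: "dilation_kernel (\<lambda>r. k r / a r) (\<lambda>r. 1 / a r)"
  by unfold_locales (auto simp: k_nonneg a_pos less_imp_le)

lemma dilation_avg_measurable:
  assumes [measurable]: "f \<in> borel_measurable borel"
  shows "dilation_avg k a f \<in> borel_measurable borel"
  unfolding dilation_avg_def[abs_def] by measurable

text \<open>The factor \<open>a r\<close> cancels the scaling of the measure, so the value is the
  same for all \<open>r\<close>.\<close>

lemma nn_integral_dilated_powr: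
  assumes f: "memLp p f"
  shows "(\<integral>\<^sup>+x. ennreal (a r * norm (f (x * a r)) powr p) \<partial>lborel) = ennreal (\<integral>x. norm (f x) powr p \<partial>lborel)"
proof -
  have [measurable]: "f \<in> borel_measurable borel" using f by (rule memLp_measurable)
  have "(\<integral>\<^sup>+x. ennreal (a r * norm (f (x * a r)) powr p) \<partial>lborel)
      = ennreal (a r) * (\<integral>\<^sup>+x. ennreal (norm (f (x * a r)) powr p) \<partial>lborel)"
    using a_pos[of r] by (subst nn_integral_cmult[symmetric]) (auto simp: ennreal_mult)
  also have "\<dots> = (\<integral>\<^sup>+x. ennreal (norm (f x) powr p) \<partial>lborel)"
    by (rule nn_integral_dilation) (auto simp: a_pos)
  also have "\<dots> = ennreal (\<integral>x. norm (f x) powr p \<partial>lborel)"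
    using f by (intro nn_integral_eq_integral) (auto simp: memLp_iff_integrable)
  finally show ?thesis .
qed

text \<open>Writing \<open>k r\<close> as \<open>m r * a r powr (1 / p)\<close>, the second factor
  turns each dilation into an isometry of L^p and the first is an integrable weight. Jensen's
  inequality for \<open>m\<close> and Tonelli's theorem then bound the average.\<close>

lemma memLp_dilation_avg:
  assumes p: "p \<ge> 1" and f: "memLp p f" and ka: "integrable lborel (\<lambda>r. k r * a r powr (- 1 / p))"
  shows "memLp p (dilation_avg k a f)"
proof -
  have [measurable]: "f \<in> borel_measurable borel" using f by (rule memLp_measurable)
  define m where "m = (\<lambda>r. k r * a r powr (- 1 / p))"
  have m: "integrable lborel m" "\<And>r. m r \<ge> 0"
    using ka by (auto simp: m_def k_nonneg)
  have [measurable]: "m \<in> borel_measurable borel" unfolding m_def by measurable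
  define K where "K = (\<integral>r. m r \<partial>lborel) powr (p - 1)"
  have ptw: "ennreal (norm (dilation_avg k a f t) powr p)
      \<le> ennreal K * (\<integral>\<^sup>+ r. ennreal (m r * (a r * norm (f (t * a r)) powr p)) \<partial>lborel)" for t
  proof -
    have "k r = m r * a r powr (1 / p)" for r
      using a_pos[of r] by (simp add: m_def powr_minus field_simps)
    then have "dilation_avg k a f t = (\<integral>r. of_real (m r) * (of_real (a r powr (1 / p)) * f (t * a r)) \<partial>lborel)"
      by (simp add: dilation_avg_def mult.assoc)
    moreover have "norm (of_real (a r powr (1 / p)) * f (t * a r)) powr p = a r * norm (f (t * a r)) powr p" for r
      using a_pos[of r] p by (simp add: norm_mult powr_mult powr_powr)
    ultimately show ?thesis
      using norm_integral_powr_le[OF m, of "\<lambda>r. of_real (a r powr (1 / p)) * f (t * a r)" p] p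
      by (simp add: K_def)
  qed
  have "(\<integral>\<^sup>+ t. ennreal (norm (dilation_avg k a f t) powr p) \<partial>lborel)
      \<le> (\<integral>\<^sup>+ t. ennreal K * (\<integral>\<^sup>+ r. ennreal (m r * (a r * norm (f (t * a r)) powr p)) \<partial>lborel) \<partial>lborel)"
    by (intro nn_integral_mono ptw)
  also have "\<dots> = ennreal K * (\<integral>\<^sup>+ t. (\<integral>\<^sup>+ r. ennreal (m r * (a r * norm (f (t * a r)) powr p)) \<partial>lborel) \<partial>lborel)"
    by (intro nn_integral_cmult) measurable
  also have "(\<integral>\<^sup>+ t. (\<integral>\<^sup>+ r. ennreal (m r * (a r * norm (f (t * a r)) powr p)) \<partial>lborel) \<partial>lborel)
     = (\<integral>\<^sup>+ r. (\<integral>\<^sup>+ t. ennreal (m r * (a r * norm (f (t * a r)) powr p)) \<partial>lborel) \<partial>lborel)"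
    by (intro lborel_pair.Fubini') measurable
  also have "\<dots> = (\<integral>\<^sup>+ r. ennreal (m r) * ennreal (\<integral>x. norm (f x) powr p \<partial>lborel) \<partial>lborel)"
  proof (intro nn_integral_cong)
    fix r
    show "(\<integral>\<^sup>+ t. ennreal (m r * (a r * norm (f (t * a r)) powr p)) \<partial>lborel) = ennreal (m r) * ennreal (\<integral>x. norm (f x) powr p \<partial>lborel)"
      using m(2)[of r] a_pos[of r]
      by (subst nn_integral_dilated_powr[OF f, symmetric, of r], subst nn_integral_cmult[symmetric])
         (auto simp: ennreal_mult)
  qed
  also have "\<dots> = ennreal (\<integral>r. m r \<partial>lborel) * ennreal (\<integral>x. norm (f x) powr p \<partial>lborel)"
    using m by (subst nn_integral_multc) (auto simp: nn_integral_eq_integral)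
  also have "ennreal K * \<dots> < \<infinity>" by (simp add: ennreal_mult_less_top)
  finally show ?thesis
    unfolding memLp_def using dilation_avg_measurable[of f] by simp
qed

text \<open>Provides the absolute integrability for Fubini's theorem. With \<open>k\<close> split as
  above, Young's inequality separates the normalised dilation of \<open>F\<close> from
  \<open>G\<close>; both terms have integrals over x that do not depend on r, and the weight is
  integrable in r.\<close>

lemma integrable_dilation_pairing:
  assumes pq: "p > 1" "q > 1" "1 / p + 1 / q = 1"
    and F: "memLp p F" and G: "memLp q G"
    and ka: "integrable lborel (\<lambda>r. k r * a r powr (- 1 / p))"
  shows "integrable (lborel \<Otimes>\<^sub>M lborel) (\<lambda>(r, x). of_real (k r) * (F (x * a r) * G x))"
proof (rule integrableI_bounded)
  have [measurable]: "F \<in> borel_measurable borel" "G \<in> borel_measurable borel"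
    using F G by (auto intro: memLp_measurable)
  show "(\<lambda>(r, x). of_real (k r) * (F (x * a r) * G x)) \<in> borel_measurable (lborel \<Otimes>\<^sub>M lborel)"
    by measurable
  define m where "m = (\<lambda>r. k r * a r powr (- 1 / p))"
  have m: "integrable lborel m" "\<And>r. m r \<ge> 0"
    using ka by (auto simp: m_def k_nonneg)
  have [measurable]: "m \<in> borel_measurable borel" unfolding m_def by measurable
  have ptw: "norm (of_real (k r) * (F (x * a r) * G x)) \<le> m r * (a r * norm (F (x * a r)) powr p + norm (G x) powr q)" for r x
  proof -
    have "k r = m r * a r powr (1 / p)"
      using a_pos[of r] by (simp add: m_def powr_minus field_simps)
    then have "norm (of_real (k r) * (F (x * a r) * G x)) = m r * ((a r powr (1 / p) * norm (F (x * a r))) * norm (G x))"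
      using m(2)[of r] by (simp add: norm_mult mult_ac)
    also have "\<dots> \<le> m r * ((a r powr (1 / p) * norm (F (x * a r))) powr p + norm (G x) powr q)"
      using m(2)[of r] pq by (intro mult_left_mono mult_le_powr_add) auto
    also have "(a r powr (1 / p) * norm (F (x * a r))) powr p = a r * norm (F (x * a r)) powr p"
      using a_pos[of r] pq by (simp add: powr_mult powr_powr)
    finally show ?thesis .
  qed
  have "(\<integral>\<^sup>+ z. ennreal (norm (case z of (r, x) \<Rightarrow> of_real (k r) * (F (x * a r) * G x))) \<partial>(lborel \<Otimes>\<^sub>M lborel))
     = (\<integral>\<^sup>+ r. \<integral>\<^sup>+ x. ennreal (norm (of_real (k r) * (F (x * a r) * G x))) \<partial>lborel \<partial>lborel)"
    by (subst lborel.nn_integral_fst[symmetric]) auto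
  also have "\<dots> \<le> (\<integral>\<^sup>+ r. \<integral>\<^sup>+ x. ennreal (m r) * (ennreal (a r * norm (F (x * a r)) powr p) + ennreal (norm (G x) powr q)) \<partial>lborel \<partial>lborel)"
    using m(2) a_pos
    by (intro nn_integral_mono)
       (subst ennreal_plus[symmetric], auto simp: less_imp_le ennreal_mult[symmetric] simp del: ennreal_plus intro!: ennreal_leI ptw)
  also have "\<dots> = (\<integral>\<^sup>+ r. ennreal (m r) * (ennreal (\<integral>x. norm (F x) powr p \<partial>lborel) + ennreal (\<integral>x. norm (G x) powr q \<partial>lborel)) \<partial>lborel)"
  proof (intro nn_integral_cong)
    fix r
    have "(\<integral>\<^sup>+ x. ennreal (norm (G x) powr q) \<partial>lborel) = ennreal (\<integral>x. norm (G x) powr q \<partial>lborel)"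
      using G by (intro nn_integral_eq_integral) (auto simp: memLp_iff_integrable)
    then show "(\<integral>\<^sup>+ x. ennreal (m r) * (ennreal (a r * norm (F (x * a r)) powr p) + ennreal (norm (G x) powr q)) \<partial>lborel)
       = ennreal (m r) * (ennreal (\<integral>x. norm (F x) powr p \<partial>lborel) + ennreal (\<integral>x. norm (G x) powr q \<partial>lborel))"
      by (simp add: nn_integral_cmult nn_integral_add nn_integral_dilated_powr[OF F])
  qed
  also have "\<dots> = ennreal (\<integral>r. m r \<partial>lborel) * (ennreal (\<integral>x. norm (F x) powr p \<partial>lborel) + ennreal (\<integral>x. norm (G x) powr q \<partial>lborel))"
    using m by (subst nn_integral_multc) (auto simp: nn_integral_eq_integral)
  also have "\<dots> < \<infinity>" by (simp add: ennreal_mult_less_top)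
  finally show "(\<integral>\<^sup>+ z. ennreal (norm (case z of (r, x) \<Rightarrow> of_real (k r) * (F (x * a r) * G x))) \<partial>(lborel \<Otimes>\<^sub>M lborel)) < \<infinity>" .
qed

text \<open>The counterpart for p = 1, with a bounded second factor such as an exponential: a
  dilation by \<open>a r\<close> divides the L^1 norm by \<open>a r\<close>, which leaves the weight
  \<open>k r / a r\<close>.\<close>

lemma integrable_dilation_pairing_L1:
  assumes F: "integrable lborel F" and [measurable]: "G \<in> borel_measurable borel" and G: "\<And>x. norm (G x) \<le> 1"
    and ka: "integrable lborel (\<lambda>r. k r / a r)"
  shows "integrable (lborel \<Otimes>\<^sub>M lborel) (\<lambda>(r, x). of_real (k r) * (F (x * a r) * G x :: complex))"
proof (rule integrableI_bounded)
  have [measurable]: "F \<in> borel_measurable borel" using F by auto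
  have F1: "memLp 1 F" using F by (auto simp: memLp_iff_integrable)
  show "(\<lambda>(r, x). of_real (k r) * (F (x * a r) * G x)) \<in> borel_measurable (lborel \<Otimes>\<^sub>M lborel)"
    by measurable
  have nn: "k r / a r \<ge> 0" for r using k_nonneg[of r] a_pos[of r] by simp
  have ptw: "norm (of_real (k r) * (F (x * a r) * G x)) \<le> k r / a r * (a r * norm (F (x * a r)) powr 1)" for r x
    using a_pos[of r] k_nonneg[of r] mult_left_mono[OF G[of x], of "norm (F (x * a r))"]
    by (auto simp: norm_mult intro!: mult_left_mono)
  have "(\<integral>\<^sup>+ z. ennreal (norm (case z of (r, x) \<Rightarrow> of_real (k r) * (F (x * a r) * G x))) \<partial>(lborel \<Otimes>\<^sub>M lborel))
     = (\<integral>\<^sup>+ r. \<integral>\<^sup>+ x. ennreal (norm (of_real (k r) * (F (x * a r) * G x))) \<partial>lborel \<partial>lborel)"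
    by (subst lborel.nn_integral_fst[symmetric]) auto
  also have "\<dots> \<le> (\<integral>\<^sup>+ r. \<integral>\<^sup>+ x. ennreal (k r / a r) * ennreal (a r * norm (F (x * a r)) powr 1) \<partial>lborel \<partial>lborel)"
  proof (intro nn_integral_mono)
    fix r x
    show "ennreal (norm (of_real (k r) * (F (x * a r) * G x))) \<le> ennreal (k r / a r) * ennreal (a r * norm (F (x * a r)) powr 1)"
      using ennreal_leI[OF ptw[of r x]] nn[of r] a_pos[of r] by (subst ennreal_mult[symmetric]) simp_all
  qed
  also have "\<dots> = (\<integral>\<^sup>+ r. ennreal (k r / a r) * ennreal (\<integral>x. norm (F x) powr 1 \<partial>lborel) \<partial>lborel)"
    by (intro nn_integral_cong) (simp add: nn_integral_cmult nn_integral_dilated_powr[OF F1, simplified])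
  also have "\<dots> = ennreal (\<integral>r. k r / a r \<partial>lborel) * ennreal (\<integral>x. norm (F x) powr 1 \<partial>lborel)"
    using ka nn by (subst nn_integral_multc) (auto simp: nn_integral_eq_integral)
  also have "\<dots> < \<infinity>" by (simp add: ennreal_mult_less_top)
  finally show "(\<integral>\<^sup>+ z. ennreal (norm (case z of (r, x) \<Rightarrow> of_real (k r) * (F (x * a r) * G x))) \<partial>(lborel \<Otimes>\<^sub>M lborel)) < \<infinity>" .
qed

end

section \<open>Products, local integrability and convergence on intervals\<close>

lemma memLp_mult_integrable:
  assumes pq: "p > 1" "q > 1" "1 / p + 1 / q = 1"
    and F: "memLp p F" and G: "memLp q G"
  shows "integrable lborel (\<lambda>x. F x * G x)"
proof (rule Bochner_Integration.integrable_bound)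
  have [measurable]: "F \<in> borel_measurable borel" "G \<in> borel_measurable borel"
    using F G by (auto intro: memLp_measurable)
  show "(\<lambda>x. F x * G x) \<in> borel_measurable lborel" by measurable
  show "integrable lborel (\<lambda>x. norm (F x) powr p + norm (G x) powr q)"
    using F G by (auto simp: memLp_iff_integrable)
  show "AE x in lborel. norm (F x * G x) \<le> norm (norm (F x) powr p + norm (G x) powr q)"
    using pq by (auto simp: norm_mult intro!: mult_le_powr_add)
qed

text \<open>Since y \<le> 1 + y^p for y \<ge> 0, the function is dominated on the interval by an
  indicator plus \<open>norm (f x) powr p\<close>.\<close>

lemma memLp_set_integrable:
  assumes p: "p \<ge> 1" and f: "memLp p f"
  shows "set_integrable lborel {c..d} f"
  unfolding set_integrable_def
proof (rule Bochner_Integration.integrable_bound)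
  have [measurable]: "f \<in> borel_measurable borel" using f by (rule memLp_measurable)
  show "(\<lambda>x. indicator {c..d} x *\<^sub>R f x) \<in> borel_measurable lborel" by measurable
  show "integrable lborel (\<lambda>x. indicator {c..d} x + norm (f x) powr p)"
    using f by (auto simp: memLp_iff_integrable emeasure_lborel_Icc_eq)
  have "y \<le> 1 + y powr p" if "y \<ge> 0" for y :: real
    using powr_mono[of 1 p y] p that powr_ge_zero[of y p] by (cases "y \<le> 1") (auto simp del: powr_ge_zero)
  then show "AE x in lborel. norm (indicator {c..d} x *\<^sub>R f x) \<le> norm (indicator {c..d} x + norm (f x) powr p)"
    by (auto split: split_indicator)
qed

text \<open>On a finite interval, \<open>y \<le> \<epsilon> + \<epsilon>\<^bsup>1-q\<^esup> y\<^sup>q\<close> replaces the use of Hoelder's inequality.\<close>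
lemma interval_integral_tendsto_0_of_Lq:
  fixes D :: "nat \<Rightarrow> real \<Rightarrow> complex"
  assumes [measurable]: "\<And>n. D n \<in> borel_measurable borel" and q: "q \<ge> 1" and cd: "c \<le> d"
    and lim: "(\<lambda>n. \<integral>\<^sup>+ t. ennreal (norm (D n t) powr q) \<partial>lborel) \<longlonglongrightarrow> 0"
  shows "(\<lambda>n. LINT t:{c..d}|lborel. D n t) \<longlonglongrightarrow> 0"
proof (rule tendstoI)
  fix e :: real assume e: "e > 0"
  \<comment> \<open>The constant term then contributes less than e/2 on [c, d]; adding 1 keeps the
    denominator positive when c = d.\<close>
  define \<epsilon> where "\<epsilon> = e / (2 * (d - c + 1))"
  have \<epsilon>: "\<epsilon> > 0" "\<epsilon> * (d - c) < e / 2"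
    using e cd by (auto simp: \<epsilon>_def field_simps)
  \<comment> \<open>The threshold is chosen so that multiplication by
    \<open>\<epsilon> powr (1 - q)\<close> gives exactly e/2.\<close>
  have "eventually (\<lambda>n. (\<integral>\<^sup>+ t. ennreal (norm (D n t) powr q) \<partial>lborel) < ennreal (e / 2 * \<epsilon> powr (q - 1))) sequentially"
    using e \<epsilon> by (intro order_tendstoD[OF lim]) simp
  then show "eventually (\<lambda>n. dist (LINT t:{c..d}|lborel. D n t) 0 < e) sequentially"
  proof eventually_elim
    case (elim n)
    have ptw: "y \<le> \<epsilon> + \<epsilon> powr (1 - q) * y powr q" if y: "y \<ge> 0" for y :: real
    proof (cases "y \<le> \<epsilon>")
      case True
      then show ?thesis by (simp add: add_increasing2)
    next
      case False
      have "1 \<le> (y / \<epsilon>) powr (q - 1)" using False \<epsilon> q by (intro ge_one_powr_ge_zero) auto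
      then have "y \<le> y * (y / \<epsilon>) powr (q - 1)" using y by (simp add: mult_le_cancel_left1)
      also have "\<dots> = \<epsilon> powr (1 - q) * y powr q"
        using \<epsilon> False by (simp add: powr_divide powr_diff field_simps)
      finally show ?thesis using \<epsilon> by simp
    qed
    have "ennreal (norm (LINT t:{c..d}|lborel. D n t)) \<le> (\<integral>\<^sup>+ t. ennreal (norm (indicator {c..d} t *\<^sub>R D n t)) \<partial>lborel)"
      unfolding set_lebesgue_integral_def
    \<comment> \<open>Without integrability the integral on the left has the default value 0 and the
      bound is trivial.\<close>
    proof (cases "integrable lborel (\<lambda>t. indicator {c..d} t *\<^sub>R D n t)")
      case True
      then show "ennreal (norm (\<integral>t. indicator {c..d} t *\<^sub>R D n t \<partial>lborel))
          \<le> (\<integral>\<^sup>+ t. ennreal (norm (indicator {c..d} t *\<^sub>R D n t)) \<partial>lborel)"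
        by (rule integral_norm_bound_ennreal)
    qed (simp add: not_integrable_integral_eq)
    also have "\<dots> \<le> (\<integral>\<^sup>+ t. ennreal \<epsilon> * indicator {c..d} t + ennreal (\<epsilon> powr (1 - q)) * ennreal (norm (D n t) powr q) \<partial>lborel)"
    proof (rule nn_integral_mono)
      fix t
      show "ennreal (norm (indicator {c..d} t *\<^sub>R D n t)) \<le> ennreal \<epsilon> * indicator {c..d} t + ennreal (\<epsilon> powr (1 - q)) * ennreal (norm (D n t) powr q)"
        using ptw[of "norm (D n t)"] \<epsilon>
        by (auto split: split_indicator simp: ennreal_mult[symmetric] ennreal_plus[symmetric] simp del: ennreal_plus intro!: ennreal_leI)
    qed
    also have "\<dots> = ennreal (\<epsilon> * (d - c)) + ennreal (\<epsilon> powr (1 - q)) * (\<integral>\<^sup>+ t. ennreal (norm (D n t) powr q) \<partial>lborel)"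
      using \<epsilon> cd by (simp add: nn_integral_add nn_integral_cmult ennreal_mult)
    also have "\<dots> \<le> ennreal (\<epsilon> * (d - c)) + ennreal (\<epsilon> powr (1 - q)) * ennreal (e / 2 * \<epsilon> powr (q - 1))"
      using elim by (intro add_left_mono mult_left_mono) auto
    also have "\<dots> = ennreal (\<epsilon> * (d - c)) + ennreal (e / 2)"
    proof -
      have "\<epsilon> powr (1 - q) * (e / 2 * \<epsilon> powr (q - 1)) = e / 2"
        using \<epsilon> by (simp add: powr_diff)
      then show ?thesis using e by (subst ennreal_mult[symmetric]) auto
    qed
    also have "\<dots> = ennreal (\<epsilon> * (d - c) + e / 2)"
      using e \<epsilon> cd by (intro ennreal_plus[symmetric]) auto
    also have "\<dots> < ennreal e" using \<epsilon> e cd by (intro ennreal_lessI) auto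
    finally show ?case by (simp add: ennreal_less_iff)
  qed
qed

section \<open>Fourier transforms of indicators of intervals\<close>

text \<open>The transform of the indicator of [c, d], kept as an integral because the closed form
  would need a separate value at x = 0.\<close>

definition interval_ft :: "real \<Rightarrow> real \<Rightarrow> real \<Rightarrow> complex" where
  "interval_ft c d x = (LINT t:{c..d}|lborel. exp (- \<i> * complex_of_real (x * t)))"

lemma interval_ft_measurable [measurable]: "interval_ft c d \<in> borel_measurable borel"
  unfolding interval_ft_def[abs_def] set_lebesgue_integral_def by measurable

lemma norm_exp_minus_i [simp]: "norm (exp (- (\<i> * complex_of_real y))) = 1"
  by (simp add: norm_exp_eq_Re)

lemma norm_interval_ft_le: "c \<le> d \<Longrightarrow> norm (interval_ft c d x) \<le> d - c"
  unfolding interval_ft_def set_lebesgue_integral_def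
  by (rule order_trans[OF integral_norm_bound]) simp

text \<open>For x \<noteq> 0 the explicit antiderivative has modulus 1/|x| at either
  endpoint.\<close>

lemma norm_interval_ft_decay:
  assumes "c \<le> d"
  shows "\<bar>x\<bar> * norm (interval_ft c d x) \<le> 2"
proof (cases "x = 0")
  case False
  define E where "E = (\<lambda>t. exp (- \<i> * complex_of_real (x * t)) / (- \<i> * complex_of_real x))"
  have "interval_ft c d x = E d - E c"
    unfolding interval_ft_def set_lebesgue_integral_def
  proof (rule integral_FTC_atLeastAtMost[OF assms])
    fix t
    show "(E has_vector_derivative exp (- \<i> * complex_of_real (x * t))) (at t within {c..d})"
    proof -
      have "((\<lambda>z. exp (- \<i> * (of_real x * z)) / (- \<i> * of_real x)) has_field_derivative
          exp (- \<i> * (of_real x * of_real t))) (at (of_real t))"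
        using False by (auto intro!: derivative_eq_intros simp: field_simps)
      from has_vector_derivative_real_field[OF this] show ?thesis by (simp add: E_def)
    qed
  qed (intro continuous_intros)
  also have "norm \<dots> \<le> norm (E d) + norm (E c)" by (rule norm_triangle_ineq4)
  also have "\<dots> = 2 / \<bar>x\<bar>" using False by (simp add: E_def norm_divide norm_mult)
  finally show ?thesis using False by (simp add: field_simps)
qed simp

text \<open>The bounds d - c and 2/|x| together give
  \<open>y\<^sup>2 * (1 + x\<^sup>2) \<le> (d - c)\<^sup>2 + 4\<close> for the modulus y. The
  remaining power q - 2 \<ge> 0 of y is bounded by that of d - c, which explains
  \<open>M\<close>.\<close>

lemma memLp_interval_ft:
  assumes q: "q \<ge> 2" and cd: "c \<le> d"
  shows "memLp q (interval_ft c d)"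
  unfolding memLp_iff_integrable
proof (rule conjI[OF interval_ft_measurable], rule Bochner_Integration.integrable_bound)
  define M where "M = (d - c) powr (q - 2) * ((d - c)\<^sup>2 + 4)"
  have "integrable lborel (\<lambda>x::real. inverse (1 + x\<^sup>2))"
    using integrable_inverse_1_plus_square by (simp add: set_integrable_def)
  then show "integrable lborel (\<lambda>x. M * inverse (1 + x\<^sup>2))" by simp
  have "norm (interval_ft c d x) powr q \<le> M * inverse (1 + x\<^sup>2)" for x
  proof (cases "interval_ft c d x = 0")
    case True
    then show ?thesis using q cd by (simp add: M_def)
  next
    case False
    define y where "y = norm (interval_ft c d x)"
    have y: "y > 0" "y \<le> d - c" "\<bar>x\<bar> * y \<le> 2"
      using False cd by (auto simp: y_def norm_interval_ft_le norm_interval_ft_decay)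
    have "y\<^sup>2 \<le> (d - c)\<^sup>2" "(\<bar>x\<bar> * y)\<^sup>2 \<le> 2\<^sup>2" using y by (intro power_mono; simp)+
    then have "y\<^sup>2 * (1 + x\<^sup>2) \<le> (d - c)\<^sup>2 + 4" by (simp add: power_mult_distrib algebra_simps)
    moreover have "1 + x\<^sup>2 > 0" by (simp add: add_pos_nonneg)
    ultimately have y2: "y\<^sup>2 \<le> ((d - c)\<^sup>2 + 4) * inverse (1 + x\<^sup>2)" by (simp add: field_simps)
    have "y powr q = y powr (q - 2) * y powr 2" by (simp add: powr_add[symmetric])
    also have "\<dots> = y powr (q - 2) * y\<^sup>2" using y by (simp add: powr_numeral)
    also have "\<dots> \<le> (d - c) powr (q - 2) * (((d - c)\<^sup>2 + 4) * inverse (1 + x\<^sup>2))"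
      using y y2 q by (intro mult_mono powr_mono2) auto
    finally show ?thesis by (simp add: y_def M_def mult.assoc)
  qed
  then show "AE x in lborel. norm (norm (interval_ft c d x) powr q) \<le> norm (M * inverse (1 + x\<^sup>2))"
    by (auto intro: order_trans[OF _ abs_ge_self] simp del: abs_mult)
qed simp_all

text \<open>Dilating the indicator of [c, d] gives that of [c/s, d/s]: the class of test functions
  is stable under dilations.\<close>

lemma interval_ft_dilation:
  assumes "s > 0"
  shows "interval_ft c d (y / s) / of_real s = interval_ft (c / s) (d / s) y"
proof -
  have "interval_ft (c / s) (d / s) y
      = (\<integral>t. (\<lambda>t. indicator {c..d} t *\<^sub>R exp (- \<i> * complex_of_real (y / s * t))) (t * s) \<partial>lborel)"
    unfolding interval_ft_def set_lebesgue_integral_def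
    using assms by (intro Bochner_Integration.integral_cong) (auto split: split_indicator simp: field_simps)
  also have "\<dots> = (\<integral>t. (indicator {c..d} t *\<^sub>R exp (- \<i> * complex_of_real (y / s * t))) / of_real s \<partial>lborel)"
    by (rule integral_dilation[OF assms])
  also have "\<dots> = interval_ft c d (y / s) / of_real s"
    unfolding interval_ft_def set_lebesgue_integral_def by (rule integral_divide_zero)
  finally show ?thesis ..
qed

section \<open>Pairing a Fourier transform with an interval\<close>

text \<open>The exponential has modulus 1, so the modulus of the integrand is a product of a
  function of x and the indicator of a bounded interval in t.\<close>

lemma integrable_trunc_fourier_kernel:
  assumes f: "set_integrable lborel {-R..R} f" and [measurable]: "f \<in> borel_measurable borel"
  shows "integrable (lborel \<Otimes>\<^sub>M lborel) (\<lambda>(x, t). indicator {c..d} t *\<^sub>R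
     (indicator {-R..R} x *\<^sub>R (exp (- \<i> * complex_of_real (x * t)) * f x)))" (is "integrable _ ?H")
proof (rule lborel_pair.Fubini_integrable)
  show "?H \<in> borel_measurable (lborel \<Otimes>\<^sub>M lborel)" by measurable
  have "(\<integral>t. norm (?H (x, t)) \<partial>lborel) = norm (indicator {-R..R} x *\<^sub>R f x) * measure lborel {c..d}" for x
    by (simp add: norm_mult mult_ac split: split_indicator)
  moreover have "integrable lborel (\<lambda>x. norm (indicator {-R..R} x *\<^sub>R f x) * measure lborel {c..d})"
    using f unfolding set_integrable_def by (intro integrable_mult_left integrable_norm)
  ultimately show "integrable lborel (\<lambda>x. \<integral>t. norm (?H (x, t)) \<partial>lborel)" by simp
  show "AE x in lborel. integrable lborel (\<lambda>t. ?H (x, t))"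
  proof (rule AE_I2)
    fix x
    show "integrable lborel (\<lambda>t. ?H (x, t))"
      by (rule Bochner_Integration.integrable_bound[where f="\<lambda>t. indicator {c..d} t * norm (f x)"])
         (auto simp: norm_mult emeasure_lborel_Icc_eq split: split_indicator)
  qed
qed

text \<open>The multiplication formula for an indicator. For truncated integrals it is Fubini's
  theorem; then the left side converges by convergence in L^q, and the right side by dominated
  convergence, as \<open>f\<close> lies in L^p and \<open>interval_ft c d\<close> in L^q.\<close>

lemma fourier_interval_pairing:
  assumes p: "1 < p" "p \<le> 2" and f: "memLp p f" and g: "is_fourier p f g" and cd: "c \<le> d"
  shows "(LINT t:{c..d}|lborel. g t) = (\<integral>x. f x * interval_ft c d x \<partial>lborel)"
proof -
  define q where "q = p / (p - 1)"
  have q: "q \<ge> 2" "1 / p + 1 / q = 1" using p by (auto simp: q_def field_simps)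
  have [measurable]: "f \<in> borel_measurable borel" using f by (rule memLp_measurable)
  have g': "memLp q g" and lim: "((\<lambda>R. \<integral>\<^sup>+ t. ennreal (norm (trunc_fourier f R t - g t) powr q) \<partial>lborel) \<longlongrightarrow> 0) at_top"
    using g p by (auto simp: is_fourier_def q_def)
  have [measurable]: "g \<in> borel_measurable borel" using g' by (rule memLp_measurable)
  have [measurable]: "trunc_fourier f R \<in> borel_measurable borel" for R
    unfolding trunc_fourier_def[abs_def] set_lebesgue_integral_def by measurable
  let ?H = "\<lambda>R x t. indicator {c..d} t *\<^sub>R (indicator {-R..R} x *\<^sub>R (exp (- \<i> * complex_of_real (x * t)) * f x))"
  have H: "integrable (lborel \<Otimes>\<^sub>M lborel) (\<lambda>(x, t). ?H R x t)" for R
    using f p by (intro integrable_trunc_fourier_kernel memLp_set_integrable[of p]) auto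
  have Ht: "(\<integral>x. ?H R x t \<partial>lborel) = indicator {c..d} t *\<^sub>R trunc_fourier f R t" for R t
    unfolding trunc_fourier_def set_lebesgue_integral_def by (rule integral_scaleR_right) 
  have Hx: "(\<integral>t. ?H R x t \<partial>lborel) = indicator {-R..R} x *\<^sub>R (f x * interval_ft c d x)" for R x
  proof -
    have "(\<integral>t. ?H R x t \<partial>lborel) = (\<integral>t. (indicator {-R..R} x *\<^sub>R f x) * (indicator {c..d} t *\<^sub>R exp (- \<i> * complex_of_real (x * t))) \<partial>lborel)"
      by (intro Bochner_Integration.integral_cong) (auto simp: scaleR_conv_of_real)
    also have "\<dots> = (indicator {-R..R} x *\<^sub>R f x) * interval_ft c d x"
      unfolding interval_ft_def set_lebesgue_integral_def by (rule integral_mult_right_zero)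
    finally show ?thesis by simp
  qed
  have trunc_int: "set_integrable lborel {c..d} (trunc_fourier f R)" for R
    using lborel_pair.integrable_snd[OF H, of R] by (simp only: Ht set_integrable_def)
  have g_int: "set_integrable lborel {c..d} g" using q g' by (intro memLp_set_integrable) auto
  have eq: "(LINT t:{c..d}|lborel. trunc_fourier f R t) = (\<integral>x. indicator {-R..R} x *\<^sub>R (f x * interval_ft c d x) \<partial>lborel)" for R
    using lborel_pair.Fubini_integral[OF H, of R] by (simp only: Ht Hx set_lebesgue_integral_def)
  \<comment> \<open>The limit is taken along integer radii, which suffices to identify it and
    matches the sequential convergence theorems.\<close>
  have "(\<lambda>n. LINT t:{c..d}|lborel. (trunc_fourier f (real n) t - g t)) \<longlonglongrightarrow> 0"
    using q cd filterlim_compose[OF lim filterlim_real_sequentially]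
    by (intro interval_integral_tendsto_0_of_Lq[of _ q]) auto
  then have "(\<lambda>n. (LINT t:{c..d}|lborel. trunc_fourier f (real n) t) - (LINT t:{c..d}|lborel. g t)) \<longlonglongrightarrow> 0"
    by (simp add: set_integral_diff(2)[OF trunc_int g_int])
  then have lim1: "(\<lambda>n. LINT t:{c..d}|lborel. trunc_fourier f (real n) t) \<longlonglongrightarrow> (LINT t:{c..d}|lborel. g t)"
    by (rule LIM_zero_cancel)
  have fi: "integrable lborel (\<lambda>x. f x * interval_ft c d x)"
    using p q f cd by (intro memLp_mult_integrable[of p q] memLp_interval_ft) auto
  have "(\<lambda>n. \<integral>x. indicator {-real n..real n} x *\<^sub>R (f x * interval_ft c d x) \<partial>lborel)
     \<longlonglongrightarrow> (\<integral>x. f x * interval_ft c d x \<partial>lborel)"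
  proof (rule integral_dominated_convergence[where w="\<lambda>x. norm (f x * interval_ft c d x)"])
    show "AE x in lborel. (\<lambda>n. indicator {-real n..real n} x *\<^sub>R (f x * interval_ft c d x)) \<longlonglongrightarrow> f x * interval_ft c d x"
    proof (rule AE_I2, rule tendsto_eventually)
      fix x :: real
      have "eventually (\<lambda>n. \<bar>x\<bar> \<le> real n) sequentially" by real_asymp
      then show "eventually (\<lambda>n. indicator {-real n..real n} x *\<^sub>R (f x * interval_ft c d x) = f x * interval_ft c d x) sequentially"
        by eventually_elim (auto split: split_indicator)
    qed
    show "AE x in lborel. norm (indicator {-real n..real n} x *\<^sub>R (f x * interval_ft c d x)) \<le> norm (f x * interval_ft c d x)" for n
      by (auto split: split_indicator)
  qed (use fi in auto)
  with lim1 show ?thesis unfolding eq by (rule LIMSEQ_unique)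
qed

section \<open>Exchange of a kernel and its dual by the Fourier transform\<close>

lemma memLp_indicator: "p > 0 \<Longrightarrow> memLp p (\<lambda>x. indicator {c..d} x :: complex)"
proof -
  assume "p > 0"
  then have "(\<lambda>x. norm (indicator {c..d} x :: complex) powr p) = indicat_real {c..d}"
    by (auto simp: fun_eq_iff split: split_indicator)
  then show ?thesis by (simp add: memLp_iff_integrable emeasure_lborel_Icc_eq)
qed

context dilation_kernel
begin

text \<open>The two weights coincide because 1/q - 1 = -1/p. Hence the condition for the kernel on
  L^p is the condition for its dual on L^q.\<close>

lemma dual_integrable:
  assumes "1 / p + 1 / q = 1" "integrable lborel (\<lambda>r. k r * a r powr (- 1 / p))"
  shows "integrable lborel (\<lambda>r. k r / a r * (1 / a r) powr (- 1 / q))"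
proof -
  have "k r / a r * (1 / a r) powr (- 1 / q) = k r * a r powr (- 1 / p)" for r
  proof -
    have "(1 / a r) powr (- 1 / q) = a r powr (1 / q)"
      using a_pos[of r] by (simp add: powr_minus powr_divide field_simps)
    moreover have "a r powr (- 1 / p) = a r powr (1 / q) / a r"
    proof -
      have "- 1 / p = 1 / q - 1" using assms(1) by simp
      then have "a r powr (- 1 / p) = a r powr (1 / q - 1)" by (simp only:)
      then show ?thesis using a_pos[of r] by (simp add: powr_diff)
    qed
    ultimately show ?thesis by simp
  qed
  with assms(2) show ?thesis by simp
qed

text \<open>Both sides have the same integral over every [c, d]: the pairing formula moves the
  interval to the side of \<open>f\<close>, Fubini's theorem reduces to a single dilation, and a
  second use of Fubini's theorem reassembles the dual average.\<close>

lemma fourier_dilation_avg: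
  assumes p: "1 < p" "p \<le> 2" and f: "memLp p f"
    and ka: "integrable lborel (\<lambda>r. k r * a r powr (- 1 / p))"
    and g: "is_fourier p f g" and h: "is_fourier p (dilation_avg k a f) h"
  shows "AE t in lborel. h t = dilation_avg (\<lambda>r. k r / a r) (\<lambda>r. 1 / a r) g t"
proof -
  define q where "q = p / (p - 1)"
  have q: "q \<ge> 2" "1 / p + 1 / q = 1" "1 / q + 1 / p = 1" using p by (auto simp: q_def field_simps)
  interpret D: dilation_kernel "\<lambda>r. k r / a r" "\<lambda>r. 1 / a r" by (rule dual)
  let ?T = "dilation_avg k a f" and ?T' = "dilation_avg (\<lambda>r. k r / a r) (\<lambda>r. 1 / a r) g"
  have T: "memLp p ?T" using p f ka by (intro memLp_dilation_avg) auto
  have g': "memLp q g" and h': "memLp q h" using g h p by (auto simp: is_fourier_def q_def)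
  have ka': "integrable lborel (\<lambda>r. k r / a r * (1 / a r) powr (- 1 / q))"
    using q(2) ka by (rule dual_integrable)
  have T': "memLp q ?T'" using q g' ka' by (intro D.memLp_dilation_avg) auto
  have ints: "set_integrable lborel {c..d} h" "set_integrable lborel {c..d} ?T'" for c d
    using memLp_set_integrable[OF _ h'] memLp_set_integrable[OF _ T'] q by auto
  have eq: "(LINT t:{c..d}|lborel. h t) = (LINT t:{c..d}|lborel. ?T' t)" if cd: "c \<le> d" for c d
  proof -
    let ?\<psi> = "interval_ft c d"
    let ?I = "\<lambda>s. indicator {c..d} s :: complex"
    have \<psi>: "memLp q ?\<psi>" using q cd by (intro memLp_interval_ft) auto
    have I: "memLp p ?I" using p by (intro memLp_indicator) auto
    \<comment> \<open>For fixed \<open>r\<close> the dilation is shifted from \<open>f\<close> to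
      the test function, which becomes the transform of a dilated interval; the pairing formula
      brings in \<open>g\<close>, and the interval is scaled back.\<close>
    have inner: "(\<integral>x. of_real (k r) * (f (x * a r) * ?\<psi> x) \<partial>lborel)
        = (\<integral>s. of_real (k r / a r) * (g (s * (1 / a r)) * ?I s) \<partial>lborel)" for r
    proof -
      have ar: "a r > 0" by (rule a_pos)
      then have cd': "c / a r \<le> d / a r" using cd by (simp add: divide_right_mono)
      have "(\<integral>x. f (x * a r) * ?\<psi> x \<partial>lborel) = (\<integral>x. (\<lambda>y. f y * ?\<psi> (y / a r)) (x * a r) \<partial>lborel)"
        using ar by simp
      also have "\<dots> = (\<integral>y. f y * ?\<psi> (y / a r) / of_real (a r) \<partial>lborel)"
        by (rule integral_dilation[OF ar])
      also have "\<dots> = (\<integral>y. f y * interval_ft (c / a r) (d / a r) y \<partial>lborel)"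
        by (simp add: interval_ft_dilation[OF ar, symmetric])
      also have "\<dots> = (LINT t:{c / a r..d / a r}|lborel. g t)"
        by (rule fourier_interval_pairing[OF p f g cd', symmetric])
      also have "\<dots> = (\<integral>t. (\<lambda>s. g (s * (1 / a r)) * ?I s) (t * a r) \<partial>lborel)"
        unfolding set_lebesgue_integral_def using ar
        by (intro Bochner_Integration.integral_cong) (auto split: split_indicator simp: field_simps)
      also have "\<dots> = (\<integral>s. g (s * (1 / a r)) * ?I s / of_real (a r) \<partial>lborel)"
        by (rule integral_dilation[OF ar])
      finally show ?thesis by simp
    qed
    have "(LINT t:{c..d}|lborel. h t) = (\<integral>x. ?T x * ?\<psi> x \<partial>lborel)"
      by (rule fourier_interval_pairing[OF p T h cd])
    \<comment> \<open>The factor moves under the inner integral at every x, including those where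
      that integral has its default value.\<close>
    also have "\<dots> = (\<integral>x. (\<integral>r. of_real (k r) * (f (x * a r) * ?\<psi> x) \<partial>lborel) \<partial>lborel)"
      unfolding dilation_avg_def mult.assoc[symmetric] integral_mult_left_zero ..
    also have "\<dots> = (\<integral>r. (\<integral>x. of_real (k r) * (f (x * a r) * ?\<psi> x) \<partial>lborel) \<partial>lborel)"
      using p q f \<psi> ka by (intro lborel_pair.Fubini_integral integrable_dilation_pairing[of p q]) auto
    also have "\<dots> = (\<integral>r. (\<integral>s. of_real (k r / a r) * (g (s * (1 / a r)) * ?I s) \<partial>lborel) \<partial>lborel)"
      unfolding inner ..
    \<comment> \<open>Here the exponents trade places: \<open>g\<close> lies in L^q, the indicator
      in L^p, and the kernel is the dual one.\<close>
    also have "\<dots> = (\<integral>s. (\<integral>r. of_real (k r / a r) * (g (s * (1 / a r)) * ?I s) \<partial>lborel) \<partial>lborel)"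
      using p q g' I ka' by (intro lborel_pair.Fubini_integral[symmetric] D.integrable_dilation_pairing[of q p]) auto
    also have "\<dots> = (\<integral>s. ?T' s * ?I s \<partial>lborel)"
      unfolding dilation_avg_def mult.assoc[symmetric] integral_mult_left_zero ..
    also have "\<dots> = (LINT t:{c..d}|lborel. ?T' t)"
      unfolding set_lebesgue_integral_def
      by (intro Bochner_Integration.integral_cong) (auto split: split_indicator)
    finally show ?thesis .
  qed
  have "AE t in lborel. h t - ?T' t = 0"
  proof (rule AE_eq_0_of_interval_integrals)
    show "set_integrable lborel {c..d} (\<lambda>t. h t - ?T' t)" for c d
      by (rule set_integral_diff(1)[OF ints])
    show "(LINT t:{c..d}|lborel. h t - ?T' t) = 0" if "c \<le> d" for c d
      using eq[OF that] by (simp add: set_integral_diff(2)[OF ints])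
  qed
  then show ?thesis by simp
qed

text \<open>For p = 1 the exponential itself is an admissible bounded factor in Fubini's theorem, so
  the identity holds at every \<open>t\<close>.\<close>

lemma fourier_L1_dilation_avg:
  assumes f: "integrable lborel f" and ka: "integrable lborel (\<lambda>r. k r / a r)"
  shows "fourier_L1 (dilation_avg k a f) t = dilation_avg (\<lambda>r. k r / a r) (\<lambda>r. 1 / a r) (fourier_L1 f) t"
proof -
  let ?e = "\<lambda>t x. exp (- \<i> * complex_of_real (x * t))"
  have "fourier_L1 (dilation_avg k a f) t = (\<integral>x. dilation_avg k a f x * ?e t x \<partial>lborel)"
    by (simp add: fourier_L1_def mult.commute)
  also have "\<dots> = (\<integral>x. (\<integral>r. of_real (k r) * (f (x * a r) * ?e t x) \<partial>lborel) \<partial>lborel)"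
    unfolding dilation_avg_def mult.assoc[symmetric] integral_mult_left_zero ..
  also have "\<dots> = (\<integral>r. (\<integral>x. of_real (k r) * (f (x * a r) * ?e t x) \<partial>lborel) \<partial>lborel)"
    using f ka by (intro lborel_pair.Fubini_integral integrable_dilation_pairing_L1) auto
  also have "\<dots> = (\<integral>r. of_real (k r / a r) * fourier_L1 f (t * (1 / a r)) \<partial>lborel)"
  proof (intro Bochner_Integration.integral_cong refl)
    fix r
    have ar: "a r > 0" by (rule a_pos)
    have "(\<integral>x. f (x * a r) * ?e t x \<partial>lborel) = (\<integral>x. (\<lambda>y. f y * ?e (t * (1 / a r)) y) (x * a r) \<partial>lborel)"
      using ar by simp
    also have "\<dots> = (\<integral>y. f y * ?e (t * (1 / a r)) y / of_real (a r) \<partial>lborel)"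
      by (rule integral_dilation[OF ar])
    also have "\<dots> = fourier_L1 f (t * (1 / a r)) / of_real (a r)"
      by (simp add: fourier_L1_def mult.commute)
    finally show "(\<integral>x. of_real (k r) * (f (x * a r) * ?e t x) \<partial>lborel) = of_real (k r / a r) * fourier_L1 f (t * (1 / a r))"
      by simp
  qed
  finally show ?thesis by (simp add: dilation_avg_def)
qed

end

section \<open>The Cesaro operators as averages of dilations\<close>

text \<open>Carries the substitution rule for absolutely integrable functions over to Bochner
  integrals of Borel functions. The two sides are integrable together; otherwise both integrals are
  0 by default.\<close>

lemma lborel_integral_change_of_variables:
  fixes \<phi> :: "real \<Rightarrow> complex"
  assumes [measurable]: "S \<in> sets borel" "g ` S \<in> sets borel" "\<phi> \<in> borel_measurable borel"
      "(\<lambda>r. \<bar>g' r\<bar> *\<^sub>R \<phi> (g r)) \<in> borel_measurable borel"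
    and der: "\<And>r. r \<in> S \<Longrightarrow> (g has_field_derivative g' r) (at r within S)" and inj: "inj_on g S"
  shows "(LINT s:g ` S|lborel. \<phi> s) = (LINT r:S|lborel. \<bar>g' r\<bar> *\<^sub>R \<phi> (g r))"
proof -
  have conv: "set_integrable lborel A F \<longleftrightarrow> F absolutely_integrable_on A"
    if "A \<in> sets borel" "F \<in> borel_measurable borel" for A and F :: "real \<Rightarrow> complex"
    using that unfolding set_integrable_def by (subst integrable_completion) auto
  have cov: "(\<lambda>r. \<bar>g' r\<bar> *\<^sub>R \<phi> (g r)) absolutely_integrable_on S \<and> integral S (\<lambda>r. \<bar>g' r\<bar> *\<^sub>R \<phi> (g r)) = b
      \<longleftrightarrow> \<phi> absolutely_integrable_on g ` S \<and> integral (g ` S) \<phi> = b" for b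
    by (rule has_absolute_integral_change_of_variables_real) (use der inj in auto)
  show ?thesis
  proof (cases "set_integrable lborel (g ` S) \<phi>")
    case True
    moreover from this have "\<phi> absolutely_integrable_on g ` S" by (subst (asm) conv) auto
    with cov[of "integral (g ` S) \<phi>"] have "(\<lambda>r. \<bar>g' r\<bar> *\<^sub>R \<phi> (g r)) absolutely_integrable_on S"
      "integral S (\<lambda>r. \<bar>g' r\<bar> *\<^sub>R \<phi> (g r)) = integral (g ` S) \<phi>" by auto
    moreover from this have "set_integrable lborel S (\<lambda>r. \<bar>g' r\<bar> *\<^sub>R \<phi> (g r))" by (subst conv) auto
    ultimately show ?thesis by (simp add: set_borel_integral_eq_integral(2))
  next
    case False
    then have "\<not> \<phi> absolutely_integrable_on g ` S" by (subst (asm) conv) auto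
    with cov have "\<not> (\<lambda>r. \<bar>g' r\<bar> *\<^sub>R \<phi> (g r)) absolutely_integrable_on S" by blast
    then have "\<not> set_integrable lborel S (\<lambda>r. \<bar>g' r\<bar> *\<^sub>R \<phi> (g r))" by (subst conv) auto
    with False show ?thesis
      by (simp add: set_integrable_def set_lebesgue_integral_def not_integrable_integral_eq)
  qed
qed

text \<open>The support is built into the weight, and it is the open interval so that the factor r
  is positive on it.\<close>

definition cesaro_weight :: "real \<Rightarrow> real \<Rightarrow> real" where
  "cesaro_weight \<beta> r = indicator {0<..<1} r * (\<beta> * (1 - r) powr (\<beta> - 1))"

text \<open>Outside the support of the weight the dilation factor is set to 1, so that it is positive everywhere.\<close>
definition dilation_factor :: "real \<Rightarrow> real" where
  "dilation_factor r = (if 0 < r \<and> r < 1 then r else 1)"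

lemma dilation_factor_pos: "dilation_factor r > 0"
  by (simp add: dilation_factor_def)

lemma cesaro_kernel: "\<beta> > 0 \<Longrightarrow> dilation_kernel (cesaro_weight \<beta>) dilation_factor"
  by unfold_locales (auto simp: cesaro_weight_def[abs_def] dilation_factor_def[abs_def])

lemma cesaro_eq_dilation_avg:
  assumes [measurable]: "f \<in> borel_measurable borel"
  shows "cesaro \<beta> f t = dilation_avg (cesaro_weight \<beta>) dilation_factor f t"
  unfolding cesaro_def dilation_avg_def set_lebesgue_integral_def
proof (rule integral_cong_AE)
  have [measurable]: "cesaro_weight \<beta> \<in> borel_measurable borel" "dilation_factor \<in> borel_measurable borel"
    by (auto simp: cesaro_weight_def[abs_def] dilation_factor_def[abs_def])
  show "(\<lambda>r. of_real (cesaro_weight \<beta> r) * f (t * dilation_factor r)) \<in> borel_measurable lborel"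
    by measurable
  \<comment> \<open>The integrands can differ only at r = 0; at r = 1 both vanish since
    \<open>0 powr (\<beta> - 1)\<close> is 0.\<close>
  have "AE r in lborel. r \<noteq> (0::real)" by (rule AE_lborel_singleton)
  then show "AE r in lborel. indicator {0..1} r *\<^sub>R (complex_of_real (\<beta> * (1 - r) powr (\<beta> - 1)) * f (t * r))
      = of_real (cesaro_weight \<beta> r) * f (t * dilation_factor r)"
  proof eventually_elim
    case (elim r)
    then show ?case
      by (cases "r = 1") (auto simp: cesaro_weight_def dilation_factor_def split: split_indicator)
  qed
qed measurable

text \<open>For s = t/r one has s - t = t (1 - r)/r. All powers of |t| cancel, and from the powers
  of r only 1/r remains.\<close>

lemma cesaro_dual_jacobian:
  fixes t r \<beta> :: real
  assumes "t \<noteq> 0" "0 < r" "r < 1"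
  shows "\<bar>- t / r\<^sup>2\<bar> * (\<beta> * \<bar>t / r - t\<bar> powr (\<beta> - 1) / \<bar>t / r\<bar> powr \<beta>) = \<beta> * (1 - r) powr (\<beta> - 1) / r"
proof -
  have "t / r - t = t * ((1 - r) / r)" using assms by (simp add: field_simps)
  then have 1: "\<bar>t / r - t\<bar> = \<bar>t\<bar> * ((1 - r) / r)" using assms by (simp add: abs_mult)
  have 2: "\<bar>t / r\<bar> = \<bar>t\<bar> / r" using assms by simp
  define P where "P = (1 - r) powr (\<beta> - 1)"
  have t: "\<bar>t\<bar> powr \<beta> = \<bar>t\<bar> powr (\<beta> - 1) * \<bar>t\<bar>" and r: "r powr \<beta> = r powr (\<beta> - 1) * r"
    using assms by (simp_all add: powr_diff)
  have 3: "(\<bar>t\<bar> * ((1 - r) / r)) powr (\<beta> - 1) = \<bar>t\<bar> powr (\<beta> - 1) * (P / r powr (\<beta> - 1))"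
    "(\<bar>t\<bar> / r) powr \<beta> = (\<bar>t\<bar> powr (\<beta> - 1) * \<bar>t\<bar>) / (r powr (\<beta> - 1) * r)"
    unfolding t[symmetric] r[symmetric] P_def using assms by (simp_all add: powr_mult powr_divide)
  have "\<bar>t\<bar> powr (\<beta> - 1) > 0" "r powr (\<beta> - 1) > 0" using assms by simp_all
  then show ?thesis using assms unfolding 1 2 3 P_def[symmetric]
    by (simp add: abs_divide power2_eq_square)
qed

lemma cesaro_dual_eq_dilation_avg:
  assumes [measurable]: "f \<in> borel_measurable borel" and t: "t \<noteq> 0"
  shows "cesaro_dual \<beta> f t = dilation_avg (\<lambda>r. cesaro_weight \<beta> r / dilation_factor r) (\<lambda>r. 1 / dilation_factor r) f t"
proof -
  let ?S = "{0<..<1::real}"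
  \<comment> \<open>Absolute values make one integrand serve both half-lines; s = t/r maps (0, 1)
    onto the half-line beyond \<open>t\<close>, whatever its sign.\<close>
  define \<phi> where "\<phi> s = complex_of_real (\<beta> * \<bar>s - t\<bar> powr (\<beta> - 1) / \<bar>s\<bar> powr \<beta>) * f s" for s
  have img: "(\<lambda>r. t / r) ` ?S = (if t < 0 then {..<t} else {t<..})" (is "_ = ?U")
  proof (intro equalityI subsetI)
    fix s assume "s \<in> (\<lambda>r. t / r) ` ?S"
    then show "s \<in> ?U" using t by (auto simp: field_simps)
  next
    fix s assume s: "s \<in> ?U"
    then have "s = t / (t / s)" "t / s \<in> ?S" using t by (auto split: if_splits simp: field_simps zero_less_divide_iff)
    then show "s \<in> (\<lambda>r. t / r) ` ?S" by (rule image_eqI)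
  qed
  have "cesaro_dual \<beta> f t = (LINT s:?U|lborel. \<phi> s)"
    unfolding cesaro_dual_def set_lebesgue_integral_def \<phi>_def using t
    by (auto intro!: Bochner_Integration.integral_cong split: split_indicator)
  also have "\<dots> = (LINT r:?S|lborel. \<bar>- t / r\<^sup>2\<bar> *\<^sub>R \<phi> (t / r))"
    unfolding img[symmetric]
  proof (rule lborel_integral_change_of_variables)
    show "(\<lambda>r. t / r) ` ?S \<in> sets borel" unfolding img by auto
    show "\<phi> \<in> borel_measurable borel" "(\<lambda>r. \<bar>- t / r\<^sup>2\<bar> *\<^sub>R \<phi> (t / r)) \<in> borel_measurable borel"
      unfolding \<phi>_def[abs_def] by measurable
    show "inj_on (\<lambda>r. t / r) ?S" using t by (auto simp: inj_on_def)
    show "((\<lambda>r. t / r) has_field_derivative - t / r\<^sup>2) (at r within ?S)" if "r \<in> ?S" for r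
      using that by (auto intro!: derivative_eq_intros simp: power2_eq_square)
  qed simp
  also have "\<dots> = dilation_avg (\<lambda>r. cesaro_weight \<beta> r / dilation_factor r) (\<lambda>r. 1 / dilation_factor r) f t"
    unfolding dilation_avg_def set_lebesgue_integral_def
  proof (rule Bochner_Integration.integral_cong)
    fix r :: real
    show "indicator ?S r *\<^sub>R \<bar>- t / r\<^sup>2\<bar> *\<^sub>R \<phi> (t / r)
        = of_real (cesaro_weight \<beta> r / dilation_factor r) * f (t * (1 / dilation_factor r))"
    proof (cases "r \<in> ?S")
      case True
      have "\<bar>- t / r\<^sup>2\<bar> *\<^sub>R \<phi> (t / r)
          = of_real (\<bar>- t / r\<^sup>2\<bar> * (\<beta> * \<bar>t / r - t\<bar> powr (\<beta> - 1) / \<bar>t / r\<bar> powr \<beta>)) * f (t / r)"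
        unfolding \<phi>_def scaleR_conv_of_real by (simp only: of_real_mult mult.assoc)
      also have "\<dots> = of_real (\<beta> * (1 - r) powr (\<beta> - 1) / r) * f (t / r)"
        using True t by (subst cesaro_dual_jacobian) auto
      finally show ?thesis using True by (simp add: cesaro_weight_def dilation_factor_def)
    qed (simp add: cesaro_weight_def)
  qed simp
  finally show ?thesis .
qed

text \<open>The Beta integral with parameters \<alpha> and \<beta>. It is used for \<alpha> = 1 -
  1/p (Cesaro operator), \<alpha> = 1/p (dual operator) and \<alpha> = 1 (dual operator on
  L^1).\<close>

lemma integrable_cesaro_weight_powr:
  assumes "\<beta> > 0" "\<alpha> > 0"
  shows "integrable lborel (\<lambda>r. cesaro_weight \<beta> r * dilation_factor r powr (\<alpha> - 1))"
proof -
  have "set_integrable lborel {0<..<1} (\<lambda>r. r powr (\<alpha> - 1) * (1 - r) powr (\<beta> - 1))"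
    by (rule set_integrable_subset[OF integrable_Beta[OF assms(2,1)]]) auto
  then have "integrable lborel (\<lambda>r. \<beta> * (indicator {0<..<1} r *\<^sub>R (r powr (\<alpha> - 1) * (1 - r) powr (\<beta> - 1))))"
    unfolding set_integrable_def by (rule integrable_mult_right)
  also have "(\<lambda>r. \<beta> * (indicator {0<..<1} r *\<^sub>R (r powr (\<alpha> - 1) * (1 - r) powr (\<beta> - 1))))
      = (\<lambda>r. cesaro_weight \<beta> r * dilation_factor r powr (\<alpha> - 1))"
    by (auto simp: fun_eq_iff cesaro_weight_def dilation_factor_def split: split_indicator)
  finally show ?thesis .
qed

section \<open>Invariance under changes on null sets, and the two identities\<close>

lemma memLp_cong_AE:
  assumes "memLp p f" "g \<in> borel_measurable borel" "AE x in lborel. f x = g x"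
  shows "memLp p g"
proof -
  have [measurable]: "f \<in> borel_measurable borel" "g \<in> borel_measurable borel"
    using assms by (auto intro: memLp_measurable)
  have "integrable lborel (\<lambda>x. norm (f x) powr p) \<longleftrightarrow> integrable lborel (\<lambda>x. norm (g x) powr p)"
    using assms(3) by (intro integrable_cong_AE) auto
  then show ?thesis using assms by (auto simp: memLp_iff_integrable)
qed

text \<open>The definition sees \<open>f\<close> only through integrals. This disposes of the point
  0, which the formula for the dual operator as an average leaves out.\<close>

lemma is_fourier_cong_AE:
  assumes [measurable]: "f \<in> borel_measurable borel" "g \<in> borel_measurable borel"
    and ae: "AE x in lborel. f x = g x"
  shows "is_fourier p f h \<longleftrightarrow> is_fourier p g h"
proof -
  have "fourier_L1 f t = fourier_L1 g t" for t
    unfolding fourier_L1_def by (rule integral_cong_AE) (use ae in auto)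
  moreover have "trunc_fourier f R t = trunc_fourier g R t" for R t
    unfolding trunc_fourier_def set_lebesgue_integral_def
    by (rule integral_cong_AE) (use ae in auto)
  ultimately show ?thesis by (simp add: is_fourier_def)
qed

theorem theorem6p4:
  fixes \<beta> :: real
  assumes "\<beta> > 0"
  shows "(\<forall>p (f :: real \<Rightarrow> complex). 1 < p \<and> p \<le> 2 \<and> memLp p f \<longrightarrow>
            memLp p (cesaro \<beta> f) \<and>
            (\<forall>g h. is_fourier p f g \<and> is_fourier p (cesaro \<beta> f) h \<longrightarrow>
               (AE t in lborel. h t = cesaro_dual \<beta> g t)))
       \<and> (\<forall>p (f :: real \<Rightarrow> complex). 1 \<le> p \<and> p \<le> 2 \<and> memLp p f \<longrightarrow>
            memLp p (cesaro_dual \<beta> f) \<and>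
            (\<forall>g h. is_fourier p f g \<and> is_fourier p (cesaro_dual \<beta> f) h \<longrightarrow>
               (AE t in lborel. h t = cesaro \<beta> g t)))"
proof (intro conjI allI impI)
  let ?w = "cesaro_weight \<beta>" and ?u = dilation_factor
  interpret C: dilation_kernel ?w ?u using assms by (rule cesaro_kernel)
  interpret D: dilation_kernel "\<lambda>r. ?w r / ?u r" "\<lambda>r. 1 / ?u r" by (rule C.dual)
  have u: "?u r > 0" for r by (rule dilation_factor_pos)
  \<comment> \<open>Dualising twice returns the Cesaro kernel, so the general lemmas applied to the
    dual kernel yield the second identity.\<close>
  have dual_dual: "(\<lambda>r. ?w r / ?u r / (1 / ?u r)) = ?w" "(\<lambda>r. 1 / (1 / ?u r)) = ?u"
    using u by (auto simp: fun_eq_iff less_imp_neq[OF u, symmetric])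
  have dual_eq: "AE t in lborel. dilation_avg (\<lambda>r. ?w r / ?u r) (\<lambda>r. 1 / ?u r) f t = cesaro_dual \<beta> f t"
    if "f \<in> borel_measurable borel" for f
    using AE_lborel_singleton[of "0::real"] by eventually_elim (simp add: cesaro_dual_eq_dilation_avg[OF that])
  {
    fix p :: real and f :: "real \<Rightarrow> complex"
    assume *: "1 < p \<and> p \<le> 2 \<and> memLp p f"
    then have f: "f \<in> borel_measurable borel" by (blast intro: memLp_measurable)
    \<comment> \<open>The Beta parameter 1 - 1/p is positive because p > 1.\<close>
    have ka: "integrable lborel (\<lambda>r. ?w r * ?u r powr (- 1 / p))"
      using integrable_cesaro_weight_powr[OF assms, of "1 - 1 / p"] * by simp
    have C: "cesaro \<beta> f = dilation_avg ?w ?u f"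
      using cesaro_eq_dilation_avg[OF f] by blast
    show "memLp p (cesaro \<beta> f)"
      unfolding C using * ka by (intro C.memLp_dilation_avg) auto
    fix g h assume gh: "is_fourier p f g \<and> is_fourier p (cesaro \<beta> f) h"
    then have "g \<in> borel_measurable borel"
      using * by (auto simp: is_fourier_def intro: memLp_measurable)
    note dual_eq[OF this]
    moreover have "AE t in lborel. h t = dilation_avg (\<lambda>r. ?w r / ?u r) (\<lambda>r. 1 / ?u r) g t"
      using * gh ka unfolding C by (intro C.fourier_dilation_avg[of p f]) auto
    ultimately show "AE t in lborel. h t = cesaro_dual \<beta> g t"
      by eventually_elim simp
  }
  {
    fix p :: real and f :: "real \<Rightarrow> complex"
    assume *: "1 \<le> p \<and> p \<le> 2 \<and> memLp p f"
    then have f [measurable]: "f \<in> borel_measurable borel" by (blast intro: memLp_measurable)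
    let ?T = "dilation_avg (\<lambda>r. ?w r / ?u r) (\<lambda>r. 1 / ?u r) f"
    have T [measurable]: "?T \<in> borel_measurable borel" by (rule D.dilation_avg_measurable[OF f])
    have "cesaro_dual \<beta> f = (\<lambda>t. if t = 0 then 0 else ?T t)"
      by (auto simp: fun_eq_iff cesaro_dual_eq_dilation_avg[OF f]) (simp add: cesaro_dual_def)
    then have C [measurable]: "cesaro_dual \<beta> f \<in> borel_measurable borel" by simp
    have ka: "integrable lborel (\<lambda>r. ?w r / ?u r * (1 / ?u r) powr (- 1 / p))"
    proof -
      have "?w r / ?u r * (1 / ?u r) powr (- 1 / p) = ?w r * ?u r powr (1 / p - 1)" for r
        using u[of r] by (simp add: powr_minus powr_divide powr_diff field_simps)
      then show ?thesis using integrable_cesaro_weight_powr[OF assms, of "1 / p"] * by simp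
    qed
    show "memLp p (cesaro_dual \<beta> f)"
      using * ka by (intro memLp_cong_AE[OF D.memLp_dilation_avg C dual_eq[OF f]]) auto
    fix g h assume gh: "is_fourier p f g \<and> is_fourier p (cesaro_dual \<beta> f) h"
    then have h: "is_fourier p ?T h"
      using is_fourier_cong_AE[OF T C dual_eq[OF f]] by simp
    show "AE t in lborel. h t = cesaro \<beta> g t"
    \<comment> \<open>For p = 1 the transforms are given by pointwise integrals; for p > 1 they are
      known only up to null sets, and the interval argument applies.\<close>
    proof (cases "p = 1")
      case True
      then have g: "g = fourier_L1 f" and h: "h = fourier_L1 ?T"
        using gh h by (auto simp: is_fourier_def)
      have g': "g \<in> borel_measurable borel" unfolding g fourier_L1_def[abs_def] by measurable
      have fi: "integrable lborel f"
        using * True integrable_norm_cancel[of lborel f] by (auto simp: memLp_iff_integrable)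
      have "integrable lborel (\<lambda>r. ?w r / ?u r / (1 / ?u r))"
        using integrable_cesaro_weight_powr[OF assms, of 1] u by (simp add: dual_dual less_imp_neq[OF u, symmetric])
      from D.fourier_L1_dilation_avg[OF fi this] show ?thesis
        unfolding h dual_dual by (simp add: cesaro_eq_dilation_avg[OF g', unfolded g] g)
    next
      case False
      with * have p: "1 < p" "p \<le> 2" by auto
      then have "g \<in> borel_measurable borel"
        using gh by (auto simp: is_fourier_def intro: memLp_measurable)
      then show ?thesis
        using D.fourier_dilation_avg[OF p _ ka _ h, of g] * gh unfolding dual_dual
        by (simp add: cesaro_eq_dilation_avg)
    qed
  }
qed

end
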